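(* Let $\mathcal{B}$ be the set of all blocking games, and let $\mathcal{P}(\mathcal{B})$ be the set of strictly $\mathscr{P}$-free elements of $\mathcal{B}$. Then $\mathcal{P}(\mathcal{B})$ is closed under disjunctive sum. Consequently, the set $\mathcal{P}_{\mathcal{B}}(\mathcal{B})$ of elements of $\mathcal{B}$ that are $\mathscr{P}$-free modulo $\mathcal{B}$ is also closed under disjunctive sum.
   Context: Games are short combinatorial game forms (no tombstones here) played under the misère convention: a player unable to move wins. The outcome $o(G)\in\{\mathscr{L},\mathscr{N},\mathscr{P},\mathscr{R}\}$: $\mathscr{L}$ if Left wins whoever starts, $\mathscr{R}$ if Right wins whoever starts, $\mathscr{N}$ if the first player wins, $\mathscr{P}$ if the second player wins. $G+H$ is the disjunctive sum. A subposition of $G$ is any game reachable from $G$ by a possibly empty, not necessarily alternating, sequence of moves (so $G$ is a subposition of itself). A game is strictly $\mathscr{P}$-free if none of its subpositions has outcome $\mathscr{P}$. For a set $\mathcal{A}$ of games, $G\geq_{\mathcal{A}}H$ means $o(G+X)\geq o(H+X)$ for all $X\in\mathcal{A}$ (outcomes ordered by $\mathscr{L}>\mathscr{N}>\mathscr{R}$, $\mathscr{L}>\mathscr{P}>\mathscr{R}$, with $\mathscr{N},\mathscr{P}$ incomparable), and $G\equiv_{\mathcal{A}}H$ means both $G\geq_{\mathcal{A}}H$ and $H\geq_{\mathcal{A}}G$. $\mathcal{P}_{\mathcal{A}}(\mathcal{A})$ is the set of $G\in\mathcal{A}$ for which there is a strictly $\mathscr{P}$-free $H\in\mathcal{A}$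 with $G\equiv_{\mathcal{A}}H$. A Left end is a game with no Left options (Right end symmetric). A Left end $X$ is blocked if for every Right option $X^R$ of $X$, either $X^R$ is a blocked Left end, or there is a Left option $X^{RL}$ of $X^R$ that is a blocked Left end; blocked Right ends are defined symmetrically. A game is blocking if every subposition that is a Left end is a blocked Left end and every subposition that is a Right end is a blocked Right end. $\mathcal{B}$ is the set of all blocking games. *)

theory Defs
  imports "HOL-Library.FSet"
begin

datatype game = Game (left_opts: "game fset") (right_opts: "game fset")

lemma size_left_opt [termination_simp]: "G |\<in>| L \<Longrightarrow> size G < size (Game L R)"
proof -
  assume "G |\<in>| L"
  then have "Suc (size G) \<le> (\<Sum>x\<in>fset L. Suc (size x))"
    by (intro member_le_sum) auto
  then show ?thesis by simp
qed

lemma size_right_opt [termination_simp]: "G |\<in>| R \<Longrightarrow> size G < size (Game L R)"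
proof -
  assume "G |\<in>| R"
  then have "Suc (size G) \<le> (\<Sum>x\<in>fset R. Suc (size x))"
    by (intro member_le_sum) auto
  then show ?thesis by simp
qed

definition left_end :: "game \<Rightarrow> bool" where
  "left_end G \<longleftrightarrow> left_opts G = {||}"

definition right_end :: "game \<Rightarrow> bool" where
  "right_end G \<longleftrightarrow> right_opts G = {||}"

function game_sum :: "game \<Rightarrow> game \<Rightarrow> game" where
  "game_sum (Game L1 R1) (Game L2 R2) =
     Game ((\<lambda>G. game_sum G (Game L2 R2)) |`| L1 |\<union>| (\<lambda>H. game_sum (Game L1 R1) H) |`| L2)
          ((\<lambda>G. game_sum G (Game L2 R2)) |`| R1 |\<union>| (\<lambda>H. game_sum (Game L1 R1) H) |`| R2)"
  by pat_completeness auto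
termination
  by (relation "measure (\<lambda>(G, H). size G + size H)")
     (simp_all add: size_left_opt size_right_opt del: game.size)

instantiation game :: plus
begin
definition plus_game :: "game \<Rightarrow> game \<Rightarrow> game" where
  "plus_game = game_sum"
instance ..
end

text \<open>Misere play: a player who has to move but has no option wins.
  There are no draws, so a player wins moving second iff the opponent does not win moving first.\<close>

function left_wins_first :: "game \<Rightarrow> bool"
  and right_wins_first :: "game \<Rightarrow> bool" where
  "left_wins_first (Game L R) \<longleftrightarrow> L = {||} \<or> (\<exists>G |\<in>| L. \<not> right_wins_first G)"
| "right_wins_first (Game L R) \<longleftrightarrow> R = {||} \<or> (\<exists>G |\<in>| R. \<not> left_wins_first G)"
  by pat_completeness auto
termination
  by (relation "measure (case_sum size size)")
     (simp_all add: size_left_opt size_right_opt del: game.size)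

datatype outcome = Outcome_L | Outcome_N | Outcome_P | Outcome_R

instantiation outcome :: order
begin

definition less_eq_outcome :: "outcome \<Rightarrow> outcome \<Rightarrow> bool" where
  "less_eq_outcome a b \<longleftrightarrow> a = b \<or> a = Outcome_R \<or> b = Outcome_L"

definition less_outcome :: "outcome \<Rightarrow> outcome \<Rightarrow> bool" where
  "less_outcome a b \<longleftrightarrow> a \<le> b \<and> \<not> b \<le> a" for a b :: outcome

instance
  by standard (auto simp: less_eq_outcome_def less_outcome_def)

end

definition game_outcome :: "game \<Rightarrow> outcome" where
  "game_outcome G =
     (if left_wins_first G
      then if right_wins_first G then Outcome_N else Outcome_L
      else if right_wins_first G then Outcome_R else Outcome_P)"

inductive subposition :: "game \<Rightarrow> game \<Rightarrow> bool" where
  refl: "subposition G G"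
| left: "subposition H G \<Longrightarrow> K |\<in>| left_opts H \<Longrightarrow> subposition K G"
| right: "subposition H G \<Longrightarrow> K |\<in>| right_opts H \<Longrightarrow> subposition K G"

definition strictly_P_free :: "game \<Rightarrow> bool" where
  "strictly_P_free G \<longleftrightarrow> (\<forall>H. subposition H G \<longrightarrow> game_outcome H \<noteq> Outcome_P)"

definition game_ge :: "game set \<Rightarrow> game \<Rightarrow> game \<Rightarrow> bool" where
  "game_ge A G H \<longleftrightarrow> (\<forall>X\<in>A. game_outcome (G + X) \<ge> game_outcome (H + X))"

definition game_equiv :: "game set \<Rightarrow> game \<Rightarrow> game \<Rightarrow> bool" where
  "game_equiv A G H \<longleftrightarrow> game_ge A G H \<and> game_ge A H G"

definition strictly_P_free_part :: "game set \<Rightarrow> game set" where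
  "strictly_P_free_part A = {G \<in> A. strictly_P_free G}"

definition P_free_mod_part :: "game set \<Rightarrow> game set" where
  "P_free_mod_part A = {G \<in> A. \<exists>H\<in>A. strictly_P_free H \<and> game_equiv A G H}"

inductive blocked_left_end :: "game \<Rightarrow> bool" where
  "left_end X \<Longrightarrow>
   (\<And>XR. XR |\<in>| right_opts X \<Longrightarrow>
      blocked_left_end XR \<or> (\<exists>XRL. XRL |\<in>| left_opts XR \<and> blocked_left_end XRL)) \<Longrightarrow>
   blocked_left_end X"

inductive blocked_right_end :: "game \<Rightarrow> bool" where
  "right_end X \<Longrightarrow>
   (\<And>XL. XL |\<in>| left_opts X \<Longrightarrow>
      blocked_right_end XL \<or> (\<exists>XLR. XLR |\<in>| right_opts XL \<and> blocked_right_end XLR)) \<Longrightarrow>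
   blocked_right_end X"

definition blocking :: "game \<Rightarrow> bool" where
  "blocking G \<longleftrightarrow>
     (\<forall>H. subposition H G \<longrightarrow>
        (left_end H \<longrightarrow> blocked_left_end H) \<and> (right_end H \<longrightarrow> blocked_right_end H))"

definition blocking_games :: "game set" where
  "blocking_games = {G. blocking G}"

end

theory Submission
  imports Defs
begin

text \<open>Call a game winning for a player if that player wins it whoever starts. Among strictly
  \<open>\<P>\<close>-free blocking games, sums of games winning for Left are winning for Left: she answers in
  the component where Right moved, and if this component has become a Left end, she makes a
  winning move elsewhere, while the blocked end does her no harm.

  Suppose that \<open>G + H\<close> is a \<open>\<P>\<close>-position of minimal size, and consider the infinite sum
  \<open>G + H + G + H + \<dots>\<close>. Any two neighbouring components form a copy of \<open>G + H\<close>; let Right and Left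
  play a winning strategy as second player in alternate copies. A reply in one copy is a first move
  in the next or the previous copy and thus triggers a reply there, so a single move of Left in the
  first component starts a play which turns out never to get stuck. Each component admits only
  finitely many moves, so the play reaches arbitrarily many components. Three consecutive
  components \<open>X\<close>, \<open>W\<close>, \<open>Z\<close> left behind, with \<open>X\<close> and \<open>Z\<close> subpositions of \<open>G\<close>, are such that \<open>X + W\<close>
  is winning for Right and \<open>W + Z\<close> for Left. The existence of such a \<open>W\<close> is a strict order, so
  \<open>G\<close> would have infinitely many subpositions.\<close>

section \<open>The semigroup of games\<close>

text \<open>The Boolean stands for a player: \<open>True\<close> for Left, \<open>False\<close> for Right.\<close>

definition moves :: "bool \<Rightarrow> game \<Rightarrow> game fset" where
  "moves p G = (if p then left_opts G else right_opts G)"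

lemma size_moves: "G' |\<in>| moves p G \<Longrightarrow> size G' < size G"
  by (cases G) (auto simp: moves_def size_left_opt size_right_opt simp del: game.size
      split: if_splits)

lemma game_eqI: "(\<And>p. moves p G = moves p H) \<Longrightarrow> G = H"
  by (metis game.expand moves_def)

lemma moves_plus:
  "moves p (G + H) = (\<lambda>G'. G' + H) |`| moves p G |\<union>| (\<lambda>H'. G + H') |`| moves p H"
  by (cases G; cases H) (simp add: moves_def plus_game_def)

lemma moves_plusE:
  assumes "K |\<in>| moves p (G + H)"
  obtains (left) G' where "G' |\<in>| moves p G" "K = G' + H"
    | (right) H' where "H' |\<in>| moves p H" "K = G + H'"
  using assms by (auto simp: moves_plus)

lemma moves_plus_leftI: "G' |\<in>| moves p G \<Longrightarrow> G' + H |\<in>| moves p (G + H)"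
  and moves_plus_rightI: "H' |\<in>| moves p H \<Longrightarrow> G + H' |\<in>| moves p (G + H)"
  by (auto simp: moves_plus)

lemma moves_plus_eq_empty_iff: "moves p (G + H) = {||} \<longleftrightarrow> moves p G = {||} \<and> moves p H = {||}"
  by (auto simp: moves_plus)

lemma game_plus_assoc: "G + H + K = G + (H + K)" for G H K :: game
proof (induction "size G + size H + size K" arbitrary: G H K rule: less_induct)
  case less
  show ?case
  proof (rule game_eqI)
    fix p
    have "(\<lambda>X. X + H + K) |`| moves p G = (\<lambda>X. X + (H + K)) |`| moves p G"
      by (intro fset.map_cong refl less) (auto dest: size_moves)
    moreover have "(\<lambda>X. G + X + K) |`| moves p H = (\<lambda>X. G + (X + K)) |`| moves p H"
      by (intro fset.map_cong refl less) (auto dest: size_moves)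
    moreover have "(\<lambda>X. G + H + X) |`| moves p K = (\<lambda>X. G + (H + X)) |`| moves p K"
      by (intro fset.map_cong refl less) (auto dest: size_moves)
    ultimately show "moves p (G + H + K) = moves p (G + (H + K))"
      by (simp add: moves_plus fimage_funion fset.map_comp comp_def sup_assoc)
  qed
qed

lemma game_plus_commute: "G + H = H + G" for G H :: game
proof (induction "size G + size H" arbitrary: G H rule: less_induct)
  case less
  show ?case
  proof (rule game_eqI)
    fix p
    have "(\<lambda>X. X + H) |`| moves p G = (\<lambda>X. H + X) |`| moves p G"
      by (intro fset.map_cong refl less) (auto dest: size_moves)
    moreover have "(\<lambda>X. G + X) |`| moves p H = (\<lambda>X. X + G) |`| moves p H"
      by (intro fset.map_cong refl less) (auto dest: size_moves)
    ultimately show "moves p (G + H) = moves p (H + G)"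
      by (simp add: moves_plus sup_commute)
  qed
qed

instance game :: ab_semigroup_add
  by standard (rule game_plus_assoc, rule game_plus_commute)


section \<open>Subpositions\<close>

lemma subposition_moves: "subposition H G \<Longrightarrow> K |\<in>| moves p H \<Longrightarrow> subposition K G"
  by (cases p) (auto simp: moves_def intro: subposition.intros)

lemma subposition_induct_moves [consumes 1, case_names refl move]:
  assumes "subposition K G"
    and "P G"
    and "\<And>p H K. subposition H G \<Longrightarrow> P H \<Longrightarrow> K |\<in>| moves p H \<Longrightarrow> P K"
  shows "P K"
  using assms
proof (induction rule: subposition.induct)
  case (refl G)
  show ?case by (rule refl.prems(1))
next
  case (left H G K)
  show ?case
    using left.prems(2)[OF left.hyps(1) left.IH[OF left.prems], where p = True and K = K]
      left.hyps(2)
    by (simp add: moves_def)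
next
  case (right H G K)
  show ?case
    using right.prems(2)[OF right.hyps(1) right.IH[OF right.prems], where p = False and K = K]
      right.hyps(2)
    by (simp add: moves_def)
qed

lemma subposition_trans: "subposition K H \<Longrightarrow> subposition H G \<Longrightarrow> subposition K G"
  by (induction rule: subposition.induct) (auto intro: subposition.intros)

lemma subposition_cases_first_move:
  "subposition K G \<Longrightarrow> K = G \<or> (\<exists>p. \<exists>G' |\<in>| moves p G. subposition K G')"
proof (induction rule: subposition_induct_moves)
  case (move p H K)
  then show ?case using subposition.refl subposition_moves by metis
qed simp

lemma size_subposition: "subposition K G \<Longrightarrow> K = G \<or> size K < size G"
  by (induction rule: subposition_induct_moves) (auto dest: size_moves)

lemma finite_subpositions: "finite {K. subposition K G}"
proof (induction "size G" arbitrary: G rule: less_induct)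
  case less
  have "{K. subposition K G} \<subseteq> insert G (\<Union>p. \<Union>G' \<in> fset (moves p G). {K. subposition K G'})"
    by (auto dest!: subposition_cases_first_move[of _ G])
  moreover have "finite \<dots>"
    using less[OF size_moves] by simp
  ultimately show ?case
    by (rule finite_subset)
qed

lemma subposition_plusE:
  assumes "subposition K (G + H)"
  obtains G' H' where "K = G' + H'" "subposition G' G" "subposition H' H"
proof -
  have "\<exists>G' H'. K = G' + H' \<and> subposition G' G \<and> subposition H' H"
    using assms
  proof (induction rule: subposition_induct_moves)
    case refl
    show ?case by (blast intro: subposition.refl)
  next
    case (move p K K')
    then show ?case by (blast elim: moves_plusE intro: subposition_moves)
  qed
  then show thesis using that by blast
qed


section \<open>Blocked ends\<close>

definition blocked_end :: "bool \<Rightarrow> game \<Rightarrow> bool" where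
  "blocked_end p G = (if p then blocked_left_end G else blocked_right_end G)"

definition secures :: "bool \<Rightarrow> (game \<Rightarrow> bool) \<Rightarrow> game \<Rightarrow> bool" where
  "secures p Q G \<longleftrightarrow> blocked_end p G \<or> (\<exists>G' |\<in>| moves p G. Q G')"

lemma secures_mono [mono]: "Q \<le> R \<Longrightarrow> secures p Q G \<longrightarrow> secures p R G"
  by (auto simp: secures_def)

lemma secures_plus:
  assumes "secures p Q G"
    and "blocked_end p G \<Longrightarrow> secures p R (G + H)"
    and "\<And>G'. G' |\<in>| moves p G \<Longrightarrow> Q G' \<Longrightarrow> R (G' + H)"
  shows "secures p R (G + H)"
  using assms moves_plus_leftI unfolding secures_def by blast

lemma blocked_end_iff:
  "blocked_end p X \<longleftrightarrow> moves p X = {||} \<and> (\<forall>Y |\<in>| moves (\<not> p) X. secures p (blocked_end p) Y)"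
  using blocked_left_end.simps[of X] blocked_right_end.simps[of X]
  by (cases p) (auto simp: blocked_end_def moves_def left_end_def right_end_def secures_def)

lemma blocked_end_plus:
  assumes "blocked_end p X" "blocked_end p Y"
  shows "blocked_end p (X + Y)"
  using assms
proof (induction "size X + size Y" arbitrary: X Y rule: less_induct)
  case less
  have reply: "secures p (blocked_end p) (X' + Y')"
    if X': "secures p (blocked_end p) X'" and Y': "blocked_end p Y'"
      and smaller: "size X' + size Y' < size X + size Y" for X' Y'
    using X'
  proof (rule secures_plus)
    show "secures p (blocked_end p) (X' + Y')" if "blocked_end p X'"
      using less.hyps[of X' Y'] that Y' smaller by (simp add: secures_def)
    show "blocked_end p (X'' + Y')" if "X'' |\<in>| moves p X'" "blocked_end p X''" for X''
      using less.hyps[of X'' Y'] that Y' smaller size_moves[of X'' p X'] by simp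
  qed
  have "secures p (blocked_end p) K" if "K |\<in>| moves (\<not> p) (X + Y)" for K
    using that
  proof (cases rule: moves_plusE)
    case (left X')
    then show ?thesis
      using reply[of X' Y] less.prems blocked_end_iff[of p X] size_moves[of X' "\<not> p" X] by simp
  next
    case (right Y')
    then show ?thesis
      using reply[of Y' X] less.prems blocked_end_iff[of p Y] size_moves[of Y' "\<not> p" Y]
      by (simp add: add.commute)
  qed
  then show ?case
    using less.prems blocked_end_iff moves_plus_eq_empty_iff by metis
qed


section \<open>Strictly P-free blocking games\<close>

definition wins_first :: "bool \<Rightarrow> game \<Rightarrow> bool" where
  "wins_first p G = (if p then left_wins_first G else right_wins_first G)"

lemma wins_first_iff:
  "wins_first p G \<longleftrightarrow> moves p G = {||} \<or> (\<exists>G' |\<in>| moves p G. \<not> wins_first (\<not> p) G')"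
  by (cases G) (auto simp: wins_first_def moves_def)

lemma game_outcome_eq_P_iff: "game_outcome G = Outcome_P \<longleftrightarrow> (\<forall>p. \<not> wins_first p G)"
  by (auto simp: game_outcome_def wins_first_def all_bool_eq)

lemma blocking_iff:
  "blocking G \<longleftrightarrow> (\<forall>H p. subposition H G \<longrightarrow> moves p H = {||} \<longrightarrow> blocked_end p H)"
  by (auto simp: blocking_def moves_def blocked_end_def left_end_def right_end_def all_bool_eq)

lemma blocking_plus: "blocking G \<Longrightarrow> blocking H \<Longrightarrow> blocking (G + H)"
  unfolding blocking_iff
  by (intro allI impI, erule subposition_plusE)
    (auto simp: moves_plus_eq_empty_iff intro: blocked_end_plus)

abbreviation P_free_blocking :: "game \<Rightarrow> bool" where
  "P_free_blocking G \<equiv> G \<in> strictly_P_free_part blocking_games"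

lemma P_free_blocking_iff:
  "P_free_blocking G \<longleftrightarrow> blocking G \<and> (\<forall>H. subposition H G \<longrightarrow> (\<exists>p. wins_first p H))"
  by (auto simp: strictly_P_free_part_def blocking_games_def strictly_P_free_def
      game_outcome_eq_P_iff)

lemma P_free_blocking_subposition:
  "P_free_blocking G \<Longrightarrow> subposition H G \<Longrightarrow> P_free_blocking H"
  unfolding P_free_blocking_iff blocking_def by (meson subposition_trans)

lemma P_free_blocking_moves: "P_free_blocking G \<Longrightarrow> H |\<in>| moves p G \<Longrightarrow> P_free_blocking H"
  by (meson P_free_blocking_subposition subposition_moves subposition.refl)

lemma P_free_blocking_end: "P_free_blocking G \<Longrightarrow> moves p G = {||} \<Longrightarrow> blocked_end p G"
  by (auto simp: P_free_blocking_iff blocking_iff intro: subposition.refl)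

lemma P_free_blocking_wins_firstI:
  assumes "P_free_blocking G" "\<not> wins_first (\<not> p) G"
  shows "wins_first p G"
proof -
  have "\<exists>q. wins_first q G"
    using assms(1) subposition.refl by (auto simp: P_free_blocking_iff)
  then show ?thesis
    using assms(2) by (cases p) (auto simp: ex_bool_eq)
qed


section \<open>Games won by a player regardless of who starts\<close>

text \<open>On strictly \<open>\<P>\<close>-free blocking games, \<open>advantage p G\<close> says that \<open>p\<close> wins \<open>G\<close> moving first or
  second. Unlike that condition, it is preserved by sums whose outcomes are not yet known to avoid
  \<open>\<P>\<close>: whenever the opponent's move leaves \<open>p\<close> without a reply in one component, that component is
  blocked and \<open>p\<close> has a good move in another one.\<close>

inductive advantage :: "bool \<Rightarrow> game \<Rightarrow> bool" for p where
  advantageI: "moves (\<not> p) G \<noteq> {||} \<Longrightarrow> secures p (advantage p) G \<Longrightarrow>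
    (\<And>G'. G' |\<in>| moves (\<not> p) G \<Longrightarrow> secures p (advantage p) G') \<Longrightarrow> advantage p G"

lemma advantage_moves_nonempty: "advantage p G \<Longrightarrow> moves (\<not> p) G \<noteq> {||}"
  and advantage_secures: "advantage p G \<Longrightarrow> secures p (advantage p) G"
  and advantage_reply: "advantage p G \<Longrightarrow> G' |\<in>| moves (\<not> p) G \<Longrightarrow> secures p (advantage p) G'"
  by (auto elim: advantage.cases)

lemma secures_wins_first:
  assumes "secures p Q G" "\<And>G'. Q G' \<Longrightarrow> \<not> wins_first (\<not> p) G'"
  shows "wins_first p G"
  using assms blocked_end_iff[of p G] wins_first_iff[of p G] by (auto simp: secures_def)

lemma advantage_not_wins_first: "advantage p G \<Longrightarrow> \<not> wins_first (\<not> p) G"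
proof (induction rule: advantage.induct)
  case (advantageI G)
  have "wins_first p G'" if "G' |\<in>| moves (\<not> p) G" for G'
    using advantageI.IH(2)[OF that] by (rule secures_wins_first) blast
  then show ?case
    using advantageI.hyps by (auto simp: wins_first_iff[of "\<not> p" G])
qed

lemma secures_advantage_wins_first: "secures p (advantage p) G \<Longrightarrow> wins_first p G"
  by (rule secures_wins_first[OF _ advantage_not_wins_first])

lemma secures_if_wins_first:
  assumes "P_free_blocking G" "wins_first p G"
    and "\<And>G'. G' |\<in>| moves p G \<Longrightarrow> P_free_blocking G' \<Longrightarrow> \<not> wins_first (\<not> p) G' \<Longrightarrow> Q G'"
  shows "secures p Q G"
  unfolding secures_def
  using assms P_free_blocking_end P_free_blocking_moves wins_first_iff[of p G] by blast

lemma advantage_if_not_wins_first: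
  assumes "P_free_blocking G" "\<not> wins_first (\<not> p) G"
  shows "advantage p G"
  using assms
proof (induction "size G" arbitrary: G rule: less_induct)
  case less
  have reply: "secures p (advantage p) K"
    if K: "P_free_blocking K" "wins_first p K" and le: "size K \<le> size G" for K
    using K
  proof (rule secures_if_wins_first)
    show "advantage p K'" if "K' |\<in>| moves p K" "P_free_blocking K'" "\<not> wins_first (\<not> p) K'" for K'
      using less.hyps[of K'] that le size_moves[of K' p K] by simp
  qed
  show ?case
  proof (rule advantageI)
    show "moves (\<not> p) G \<noteq> {||}"
      using less.prems(2) wins_first_iff by blast
    show "secures p (advantage p) G"
      using reply less.prems P_free_blocking_wins_firstI by blast
    show "secures p (advantage p) G'" if "G' |\<in>| moves (\<not> p) G" for G'
      using reply[of G'] that less.prems(2) P_free_blocking_moves[OF less.prems(1) that]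
        size_moves[OF that] wins_first_iff[of "\<not> p" G]
      by auto
  qed
qed

lemma advantage_plusI:
  assumes "advantage p H" "secures p (advantage p) (G + H)"
    and "\<And>G'. G' |\<in>| moves (\<not> p) G \<Longrightarrow> secures p (advantage p) (G' + H)"
    and "\<And>H'. H' |\<in>| moves (\<not> p) H \<Longrightarrow> secures p (advantage p) (G + H')"
  shows "advantage p (G + H)"
proof (rule advantageI)
  show "moves (\<not> p) (G + H) \<noteq> {||}"
    using advantage_moves_nonempty[OF assms(1)] by (simp add: moves_plus_eq_empty_iff)
  show "secures p (advantage p) K" if "K |\<in>| moves (\<not> p) (G + H)" for K
    using that assms(3,4) by (cases rule: moves_plusE) auto
qed (rule assms(2))

lemma blocked_end_plus_advantage:
  assumes "blocked_end p X" "advantage p Y"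
  shows "advantage p (X + Y)"
  using assms
proof (induction "size X + size Y" arbitrary: X Y rule: less_induct)
  case less
  have reply: "secures p (advantage p) (X' + Y')"
    if X': "blocked_end p X'" and Y': "secures p (advantage p) Y'"
      and le: "size X' + size Y' \<le> size X + size Y" for X' Y'
    unfolding add.commute[of X' Y'] using Y'
  proof (rule secures_plus)
    show "secures p (advantage p) (Y' + X')" if "blocked_end p Y'"
      using that X' blocked_end_plus by (simp add: secures_def)
    show "advantage p (Y'' + X')" if "Y'' |\<in>| moves p Y'" "advantage p Y''" for Y''
      using less.hyps[of X' Y''] that X' le size_moves[of Y'' p Y'] by (simp add: add.commute)
  qed
  show ?case
  proof (rule advantage_plusI)
    show "secures p (advantage p) (X + Y)"
      using reply less.prems advantage_secures by blast
    show "secures p (advantage p) (X + Y')" if "Y' |\<in>| moves (\<not> p) Y" for Y'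
      using reply[of X Y'] less.prems advantage_reply that size_moves[OF that] by simp
    fix X' assume X': "X' |\<in>| moves (\<not> p) X"
    then have "secures p (blocked_end p) X'"
      using less.prems(1) blocked_end_iff by blast
    then show "secures p (advantage p) (X' + Y)"
    proof (rule secures_plus)
      show "secures p (advantage p) (X' + Y)" if "blocked_end p X'"
        using reply[of X' Y] that less.prems(2) advantage_secures size_moves[OF X'] by simp
      show "advantage p (X'' + Y)" if "X'' |\<in>| moves p X'" "blocked_end p X''" for X''
        using less.hyps[of X'' Y] that less.prems(2) size_moves[OF X'] size_moves[of X'' p X']
        by simp
    qed
  qed (rule less.prems(2))
qed

lemma blocked_end_plus_secures_advantage:
  assumes "blocked_end p X" "secures p (advantage p) Y"
  shows "secures p (advantage p) (X + Y)"
  unfolding add.commute[of X Y] using assms(2)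
  by (rule secures_plus)
    (use assms(1) blocked_end_plus blocked_end_plus_advantage in
      \<open>auto simp: secures_def add.commute[of _ X]\<close>)

lemma advantage_plus:
  assumes "advantage p G" "advantage p H"
  shows "advantage p (G + H)"
  using assms
proof (induction "size G + size H" arbitrary: G H rule: less_induct)
  case less
  have reply: "secures p (advantage p) (G' + H')"
    if G': "secures p (advantage p) G'" and H': "advantage p H'"
      and le: "size G' + size H' \<le> size G + size H" for G' H'
    using G'
  proof (rule secures_plus)
    show "secures p (advantage p) (G' + H')" if "blocked_end p G'"
      using that H' by (intro advantage_secures blocked_end_plus_advantage)
    show "advantage p (G'' + H')" if "G'' |\<in>| moves p G'" "advantage p G''" for G''
      using less.hyps[of G'' H'] that H' le size_moves[of G'' p G'] by simp
  qed
  show ?case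
  proof (rule advantage_plusI)
    show "secures p (advantage p) (G + H)"
      using reply less.prems advantage_secures by blast
    show "secures p (advantage p) (G' + H)" if "G' |\<in>| moves (\<not> p) G" for G'
      using reply[of G' H] less.prems advantage_reply that size_moves[OF that] by simp
    show "secures p (advantage p) (G + H')" if "H' |\<in>| moves (\<not> p) H" for H'
      using reply[of H' G] less.prems advantage_reply that size_moves[OF that]
      by (simp add: add.commute)
  qed (rule less.prems(2))
qed

lemma advantage_plus_secures_advantage:
  assumes "advantage p G" "secures p (advantage p) H"
  shows "secures p (advantage p) (G + H)"
  unfolding add.commute[of G H] using assms(2)
  by (rule secures_plus)
    (use assms(1) in \<open>auto intro: advantage_secures blocked_end_plus_advantage advantage_plus\<close>)

lemma wins_first_plus:
  assumes "P_free_blocking G" "P_free_blocking H"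
    and "moves p G = {||} \<or> \<not> wins_first (\<not> p) G" "wins_first p H"
  shows "wins_first p (G + H)"
proof -
  have "secures p (advantage p) H"
    using assms(2,4) advantage_if_not_wins_first by (rule secures_if_wins_first)
  moreover have "blocked_end p G \<or> advantage p G"
    using assms(1,3) P_free_blocking_end advantage_if_not_wins_first by blast
  ultimately show ?thesis
    using secures_advantage_wins_first blocked_end_plus_secures_advantage
      advantage_plus_secures_advantage by blast
qed


section \<open>A strict order on games\<close>

text \<open>Think of \<open>W\<close> as the negative of a game lying between \<open>X\<close> and \<open>Z\<close>.\<close>

definition strictly_below :: "game \<Rightarrow> game \<Rightarrow> bool" where
  "strictly_below X Z \<longleftrightarrow> (\<exists>W. advantage False (X + W) \<and> advantage True (W + Z))"

lemma strictly_below_irrefl: "\<not> strictly_below X X"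
  using secures_advantage_wins_first[of False] advantage_secures[of False]
    advantage_not_wins_first[of True]
  by (fastforce simp: strictly_below_def add.commute[of X])

lemma strictly_below_trans:
  assumes "strictly_below X Y" "strictly_below Y Z"
  shows "strictly_below X Z"
proof -
  obtain V W where "advantage False (X + V)" "advantage True (V + Y)"
    "advantage False (Y + W)" "advantage True (W + Z)"
    using assms by (auto simp: strictly_below_def)
  then have "advantage False (X + (V + Y + W))" "advantage True (V + Y + W + Z)"
    using advantage_plus[of False "X + V" "Y + W"] advantage_plus[of True "V + Y" "W + Z"]
    by (simp_all add: add.assoc)
  then show ?thesis
    by (auto simp: strictly_below_def)
qed

lemma strictly_below_chain_inj_on:
  assumes "\<And>i. i < n \<Longrightarrow> strictly_below (f i) (f (Suc i))"
  shows "inj_on f {..n}"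
proof (rule linorder_inj_onI)
  fix i j assume "i < j" "j \<in> {..n}"
  have "strictly_below (f i) (f j)"
    using Suc_leI[OF \<open>i < j\<close>] \<open>j \<in> {..n}\<close>
  proof (induction j rule: dec_induct)
    case base
    then show ?case using assms by simp
  next
    case (step j)
    then show ?case using assms strictly_below_trans[of "f i" "f j"] by simp
  qed
  then show "f i \<noteq> f j"
    using strictly_below_irrefl by metis
qed auto


section \<open>A minimal sum with outcome P\<close>

locale minimal_P_sum =
  fixes G H :: game
  assumes P_free_blocking_summands: "P_free_blocking G" "P_free_blocking H"
    and not_wins_first_sum: "\<not> wins_first p (G + H)"
    and P_free_blocking_proper: "subposition G' G \<Longrightarrow> subposition H' H \<Longrightarrow>
      G' \<noteq> G \<or> H' \<noteq> H \<Longrightarrow> P_free_blocking (G' + H')"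
    and left_wins_first_right_summand: "wins_first True H"
begin

definition start :: "nat \<Rightarrow> game" where
  "start k = (if even k then G else H)"

lemma P_free_blocking_start: "subposition X (start k) \<Longrightarrow> P_free_blocking X"
  using P_free_blocking_summands P_free_blocking_subposition
  by (auto simp: start_def split: if_splits)

lemma P_free_blocking_adjacent:
  assumes "subposition X (start k)" "subposition Y (start (Suc k))" "X \<noteq> start k"
  shows "P_free_blocking (X + Y)"
  using assms P_free_blocking_proper[of X Y] P_free_blocking_proper[of Y X]
  by (auto simp: start_def add.commute split: if_splits)

end

text \<open>The two players move alternately in the infinite sum of \<open>G, H, G, H, \<dots>\<close>, whose components
  have become \<open>s 0, s 1, \<dots>\<close>. The neighbours \<open>s k\<close> and \<open>s (Suc k)\<close> form a copy of \<open>G + H\<close>, in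
  which one player, Right for even \<open>k\<close> and Left for odd \<open>k\<close>, follows a winning strategy as second
  player. A reply made in this copy is a first move in the copy on one side of it, to be answered
  by the other player there. The copy that awaits an answer is the one ending in \<open>s t\<close>; for
  \<open>t = 0\<close> instead, Left may move freely in \<open>s 0\<close>.\<close>

locale relay = minimal_P_sum +
  fixes s :: "nat \<Rightarrow> game" and t m :: nat
  assumes subposition_start: "subposition (s k) (start k)"
    and answered: "Suc k \<noteq> t \<Longrightarrow> \<not> wins_first (even k) (s k + s (Suc k))"
    and pending: "t = Suc k \<Longrightarrow> wins_first (odd k) (s k + s (Suc k))"
    and touched_iff: "s k \<noteq> start k \<longleftrightarrow> k < m"
    and pending_le: "t \<le> m"
begin

lemma P_free_blocking_component: "P_free_blocking (s k)"
  using P_free_blocking_start subposition_start by blast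

text \<open>A missing reply would propagate along the components up to the untouched ones.\<close>

lemma reply_exists: "moves (even t) (s t) \<noteq> {||}"
proof
  assume stuck: "moves (even t) (s t) = {||}"
  have lost: "moves (even j) (s j) = {||} \<or> \<not> wins_first (odd j) (s j)" if "t \<le> j" for j
    using that
  proof (induction j rule: dec_induct)
    case base
    then show ?case using stuck by blast
  next
    case (step j)
    then have "\<not> wins_first (even j) (s (Suc j))"
      using wins_first_plus[of "s j" "s (Suc j)" "even j"]
        P_free_blocking_component answered[of j] by auto
    then show ?case by simp
  qed
  define j where "j = 2 * m + 1"
  have "s j = H"
    using touched_iff[of j] by (auto simp: j_def start_def)
  have "t \<le> 2 * m"
    using pending_le by simp
  then have "\<not> wins_first True (s j)"
    using wins_first_plus[of "s (2 * m)" "s j" True] lost[of "2 * m"]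
      P_free_blocking_component answered[of "2 * m"] by (auto simp: j_def)
  then show False
    using left_wins_first_right_summand \<open>s j = H\<close> by simp
qed

lemma components_strictly_below:
  assumes "t = m" "2 * l + 2 < m"
  shows "strictly_below (s (2 * l)) (s (2 * l + 2))"
proof -
  have "advantage (odd k) (s k + s (Suc k))" if "Suc k < m" for k
  proof (rule advantage_if_not_wins_first)
    show "P_free_blocking (s k + s (Suc k))"
      using that touched_iff[of k]
      by (intro P_free_blocking_adjacent[of _ k] subposition_start) simp
    show "\<not> wins_first (\<not> odd k) (s k + s (Suc k))"
      using that assms(1) answered by simp
  qed
  from this[of "2 * l"] this[of "2 * l + 1"]
  have "advantage False (s (2 * l) + s (2 * l + 1))"
    "advantage True (s (2 * l + 1) + s (2 * l + 2))"
    using assms(2) by simp_all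
  then show ?thesis
    unfolding strictly_below_def by blast
qed

lemma touched_bound:
  assumes "t = m"
  shows "m \<le> 2 * card {K. subposition K G}"
proof (rule ccontr)
  define N where "N = card {K. subposition K G}"
  assume "\<not> ?thesis"
  then have "inj_on (\<lambda>l. s (2 * l)) {..N}"
    using assms components_strictly_below
    by (intro strictly_below_chain_inj_on) (simp add: N_def)
  then have "card ((\<lambda>l. s (2 * l)) ` {..N}) = Suc N"
    by (simp add: card_image)
  moreover have "(\<lambda>l. s (2 * l)) ` {..N} \<subseteq> {K. subposition K G}"
    using subposition_start[of "2 * _"] by (auto simp: start_def)
  then have "card ((\<lambda>l. s (2 * l)) ` {..N}) \<le> N"
    unfolding N_def by (intro card_mono finite_subpositions)
  ultimately show False by simp
qed

lemma winning_replyE: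
  obtains r X where "r = t \<or> Suc r = t" "X |\<in>| moves (even t) (s r)"
    "\<And>k. t = Suc k \<Longrightarrow> \<not> wins_first (even k) ((s(r := X)) k + (s(r := X)) (Suc k))"
proof (cases t)
  case 0
  then show ?thesis using reply_exists that[of t] by auto
next
  case (Suc k)
  obtain K where K: "K |\<in>| moves (even t) (s k + s t)" "\<not> wins_first (odd t) K"
    using pending[OF Suc] reply_exists wins_first_iff[of "even t" "s k + s t"] Suc
    by (auto simp: moves_plus_eq_empty_iff)
  from K(1) show ?thesis
  proof (cases rule: moves_plusE)
    case (left X)
    then show ?thesis using that[of k X] K(2) Suc by simp
  next
    case (right X)
    then show ?thesis using that[of t X] K(2) Suc by simp
  qed
qed

lemma wins_first_after_move:
  assumes "Suc k \<noteq> t" "r = k \<or> r = Suc k" "X |\<in>| moves (even k) (s r)"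
  shows "wins_first (odd k) ((s(r := X)) k + (s(r := X)) (Suc k))"
proof -
  have "(s(r := X)) k + (s(r := X)) (Suc k) |\<in>| moves (even k) (s k + s (Suc k))"
    using assms(2,3) moves_plus_leftI moves_plus_rightI by auto
  then show ?thesis
    using answered[OF assms(1)] wins_first_iff[of "even k" "s k + s (Suc k)"] by auto
qed

lemma relay_reply:
  assumes r: "r = t \<or> Suc r = t" and X: "X |\<in>| moves (even t) (s r)"
    and reply: "\<And>k. t = Suc k \<Longrightarrow> \<not> wins_first (even k) ((s(r := X)) k + (s(r := X)) (Suc k))"
  shows "relay G H (s(r := X)) (if r = t then Suc t else r) (max m (Suc r))"
proof unfold_locales
  define s' where "s' = s(r := X)"
  define t' where "t' = (if r = t then Suc t else r)"
  fix k
  show "subposition (s' k) (start k)"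
    using subposition_start subposition_moves[OF subposition_start X] by (simp add: s'_def)
  show "\<not> wins_first (even k) (s' k + s' (Suc k))" if "Suc k \<noteq> t'"
  proof (cases "t = Suc k")
    case True
    then show ?thesis using reply by (simp add: s'_def)
  next
    case False
    then have "r \<noteq> k" "r \<noteq> Suc k"
      using that r by (auto simp: t'_def split: if_splits)
    then show ?thesis using answered[of k] False by (simp add: s'_def)
  qed
  show "wins_first (odd k) (s' k + s' (Suc k))" if "t' = Suc k"
  proof -
    have "r = k \<or> r = Suc k" "even t = even k" "Suc k \<noteq> t"
      using that r by (auto simp: t'_def split: if_splits)
    then show ?thesis
      using wins_first_after_move X by (simp add: s'_def)
  qed
  have "X \<noteq> start r"
    using size_moves[OF X] size_subposition[OF subposition_start[of r]] by auto
  then show "s' k \<noteq> start k \<longleftrightarrow> k < max m (Suc r)"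
    using touched_iff[of k] r pending_le by (auto simp: s'_def)
  show "t' \<le> max m (Suc r)"
    using r pending_le by (auto simp: t'_def)
qed

end

context minimal_P_sum
begin

lemma relay_start: "relay G H start 0 0"
  by unfold_locales
    (use not_wins_first_sum in \<open>auto simp: start_def add.commute[of H G] intro: subposition.refl\<close>)

lemma relay_touched_gt:
  assumes "relay G H s t m"
  shows "2 * card {K. subposition K G} < m"
  using assms
proof (induction "\<Sum>k<2 * card {K. subposition K G}. size (s k)" arbitrary: s t m rule: less_induct)
  case less
  define N where "N = 2 * card {K. subposition K G}"
  interpret relay G H s t m by (rule less.prems)
  obtain r X where r: "r = t \<or> Suc r = t" and X: "X |\<in>| moves (even t) (s r)"
    and reply: "\<And>k. t = Suc k \<Longrightarrow> \<not> wins_first (even k) ((s(r := X)) k + (s(r := X)) (Suc k))"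
    using winning_replyE by blast
  define t' where "t' = (if r = t then Suc t else r)"
  have relay': "relay G H (s(r := X)) t' (max m (Suc r))"
    unfolding t'_def using r X reply by (rule relay_reply)
  show ?case
  proof (rule ccontr)
    assume "\<not> ?thesis"
    moreover have "max m (Suc r) \<le> N" if "\<not> r < m"
    proof -
      have "t' = max m (Suc r)"
        using that r pending_le by (auto simp: t'_def)
      then show ?thesis
        unfolding N_def using relay.touched_bound[OF relay'] by simp
    qed
    ultimately have bound: "max m (Suc r) \<le> N"
      by (cases "r < m") (simp_all add: N_def)
    then have "(\<Sum>k<N. size ((s(r := X)) k)) < (\<Sum>k<N. size (s k))"
      using size_moves[OF X] by (intro sum_strict_mono_ex1) auto
    then have "N < max m (Suc r)"
      using less.hyps relay' unfolding N_def by blast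
    then show False using bound by simp
  qed
qed

end

lemma not_minimal_P_sum: "\<not> minimal_P_sum G H"
  using minimal_P_sum.relay_touched_gt minimal_P_sum.relay_start by blast

lemma wins_first_plus_if_proper_P_free_blocking:
  assumes "P_free_blocking G" "P_free_blocking H"
    and proper: "\<And>G' H'. subposition G' G \<Longrightarrow> subposition H' H \<Longrightarrow> G' \<noteq> G \<or> H' \<noteq> H \<Longrightarrow>
      P_free_blocking (G' + H')"
  shows "\<exists>p. wins_first p (G + H)"
proof (rule ccontr)
  assume P: "\<nexists>p. wins_first p (G + H)"
  then have "wins_first True G \<or> wins_first True H"
    using assms(1,2) wins_first_plus[of G H False]
      P_free_blocking_wins_firstI[of H False] by auto
  then show False
  proof
    assume "wins_first True H"
    then have "minimal_P_sum G H"
      using assms P by unfold_locales auto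
    then show False using not_minimal_P_sum by blast
  next
    assume "wins_first True G"
    moreover have "P_free_blocking (H' + G')"
      if "subposition H' H" "subposition G' G" "H' \<noteq> H \<or> G' \<noteq> G" for G' H'
      using proper[of G' H'] that by (auto simp: add.commute)
    ultimately have "minimal_P_sum H G"
      using assms(1,2) P by unfold_locales (auto simp: add.commute)
    then show False using not_minimal_P_sum by blast
  qed
qed


section \<open>Closure under sums\<close>

lemma P_free_blocking_plus:
  assumes "P_free_blocking G" "P_free_blocking H"
  shows "P_free_blocking (G + H)"
  using assms
proof (induction "size G + size H" arbitrary: G H rule: less_induct)
  case less
  have proper: "P_free_blocking (G' + H')"
    if "subposition G' G" "subposition H' H" "G' \<noteq> G \<or> H' \<noteq> H" for G' H'
    using less.hyps[of G' H'] that less.prems P_free_blocking_subposition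
      size_subposition[of G' G] size_subposition[of H' H]
    by fastforce
  show ?case
    unfolding P_free_blocking_iff
  proof (intro conjI allI impI)
    show "blocking (G + H)"
      using less.prems by (simp add: P_free_blocking_iff blocking_plus)
    fix K assume "subposition K (G + H)"
    then obtain G' H' where K: "K = G' + H'" "subposition G' G" "subposition H' H"
      by (rule subposition_plusE)
    show "\<exists>p. wins_first p K"
    proof (cases "G' = G \<and> H' = H")
      case True
      then show ?thesis
        using wins_first_plus_if_proper_P_free_blocking[OF less.prems proper] K(1) by simp
    next
      case False
      then show ?thesis
        using proper K subposition.refl by (auto simp: P_free_blocking_iff)
    qed
  qed
qed

lemma game_equiv_plus:
  assumes "\<And>X Y. X \<in> A \<Longrightarrow> Y \<in> A \<Longrightarrow> X + Y \<in> A"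
    and "H \<in> A" "G' \<in> A" "game_equiv A G G'" "game_equiv A H H'"
  shows "game_equiv A (G + H) (G' + H')"
proof -
  have "game_outcome (G + H + X) = game_outcome (G' + H' + X)" if "X \<in> A" for X
  proof -
    have "game_outcome (G + (H + X)) = game_outcome (G' + (H + X))"
      using assms that by (simp add: game_equiv_def game_ge_def order_antisym)
    moreover have "game_outcome (H + (G' + X)) = game_outcome (H' + (G' + X))"
      using assms that by (simp add: game_equiv_def game_ge_def order_antisym)
    ultimately show ?thesis
      by (simp add: ac_simps)
  qed
  then show ?thesis
    by (simp add: game_equiv_def game_ge_def)
qed

lemma P_free_mod_part_plus:
  assumes closed: "\<And>X Y. X \<in> A \<Longrightarrow> Y \<in> A \<Longrightarrow> X + Y \<in> A"
    and P_free_closed: "\<And>X Y. X \<in> strictly_P_free_part A \<Longrightarrow> Y \<in> strictly_P_free_part A \<Longrightarrow>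
      X + Y \<in> strictly_P_free_part A"
    and "G \<in> P_free_mod_part A" "H \<in> P_free_mod_part A"
  shows "G + H \<in> P_free_mod_part A"
proof -
  obtain G' H' where "G' \<in> strictly_P_free_part A" "game_equiv A G G'"
    "H' \<in> strictly_P_free_part A" "game_equiv A H H'"
    using assms(3,4) by (auto simp: P_free_mod_part_def strictly_P_free_part_def)
  moreover have "G \<in> A" "H \<in> A"
    using assms(3,4) by (auto simp: P_free_mod_part_def)
  ultimately have "game_equiv A (G + H) (G' + H')" "G' + H' \<in> strictly_P_free_part A" "G + H \<in> A"
    using closed P_free_closed game_equiv_plus[of A H G' G H']
    by (auto simp: strictly_P_free_part_def)
  then show ?thesis
    by (auto simp: P_free_mod_part_def strictly_P_free_part_def)
qed

theorem theorem4p9: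
  shows "(\<forall>G \<in> strictly_P_free_part blocking_games. \<forall>H \<in> strictly_P_free_part blocking_games.
            G + H \<in> strictly_P_free_part blocking_games) \<and>
         (\<forall>G \<in> P_free_mod_part blocking_games. \<forall>H \<in> P_free_mod_part blocking_games.
            G + H \<in> P_free_mod_part blocking_games)"
proof (intro conjI ballI)
  fix G H
  assume "G \<in> strictly_P_free_part blocking_games" "H \<in> strictly_P_free_part blocking_games"
  then show "G + H \<in> strictly_P_free_part blocking_games"
    by (rule P_free_blocking_plus)
next
  fix G H
  assume "G \<in> P_free_mod_part blocking_games" "H \<in> P_free_mod_part blocking_games"
  then show "G + H \<in> P_free_mod_part blocking_games"
    by (intro P_free_mod_part_plus[OF _ P_free_blocking_plus])
      (auto simp: blocking_games_def blocking_plus)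
qed

end
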